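(* Let $[a,b]\subset\mathbb{R}_+$ and let $f_1,f_2:[a,b]\to\mathbb{R}$ be functions that are twice differentiable on $(a,b)$. Suppose $f_2''(x)>0$ for all $x\in(a,b)$ and that there are real numbers $\alpha,\beta$ such that $$\alpha\le \frac{f_1''(x)}{f_2''(x)}\le\beta\qquad\text{for all }x\in(a,b).$$ Let $n\ge 2$, let $\lambda=(\lambda_1,\dots,\lambda_n)\in\Gamma_n$, let $X=(x_1,\dots,x_n)$ with $x_i\in(a,b)$ for all $i$, and let $\eta_1,\eta_2\in(a,b)$ satisfy $\eta_1\le x_i\le\eta_2$ for all $i=1,\dots,n$. Then $$\alpha\,F_{f_2}(\lambda,X)\le F_{f_1}(\lambda,X)\le\beta\,F_{f_2}(\lambda,X),$$ $$\alpha\left[L_{f_2}(\lambda,X)-F_{f_2}(\lambda,X)\right]\le L_{f_1}(\lambda,X)-F_{f_1}(\lambda,X)\le\beta\left[L_{f_2}(\lambda,X)-F_{f_2}(\lambda,X)\right],$$ and $$\alpha\left[Z_{f_2}(\eta_1,\eta_2)-F_{f_2}(\lambda,X)\right]\le Z_{f_1}(\eta_1,\eta_2)-F_{f_1}(\lambda,X)\le\beta\left[Z_{f_2}(\eta_1,\eta_2)-F_{f_2}(\lambda,X)\right].$$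
   Context: $\Gamma_n=\{(p_1,\dots,p_n): p_i>0,\ \sum_{i=1}^n p_i=1\}$, $n\ge2$. For a function $f$ differentiable at the points involved, define $$F_f(\lambda,X)=\sum_{i=1}^n\lambda_i f(x_i)-f\Big(\sum_{i=1}^n\lambda_i x_i\Big),$$ $$L_f(\lambda,X)=\sum_{i=1}^n\lambda_i x_i f'(x_i)-\Big(\sum_{i=1}^n\lambda_i x_i\Big)\Big(\sum_{i=1}^n\lambda_i f'(x_i)\Big),$$ $$Z_f(\eta_1,\eta_2)=\tfrac14(\eta_2-\eta_1)\left[f'(\eta_2)-f'(\eta_1)\right].$$ *)

theory Defs
  imports "HOL-Analysis.Analysis"
begin

(* An n-tuple is a function nat => real of which only the values at 1, ..., n matter. *)

definition Gamma_simplex :: "nat \<Rightarrow> (nat \<Rightarrow> real) set" where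
  "Gamma_simplex n = {p. (\<forall>i\<in>{1..n}. 0 < p i) \<and> (\<Sum>i=1..n. p i) = 1}"

(* Intended for open S, where deriv depends only on the values of f in S. *)
definition twice_differentiable_on :: "(real \<Rightarrow> real) \<Rightarrow> real set \<Rightarrow> bool" where
  "twice_differentiable_on f S \<longleftrightarrow>
     (\<forall>x\<in>S. f differentiable (at x)) \<and> (\<forall>x\<in>S. deriv f differentiable (at x))"

definition F_functional :: "nat \<Rightarrow> (real \<Rightarrow> real) \<Rightarrow> (nat \<Rightarrow> real) \<Rightarrow> (nat \<Rightarrow> real) \<Rightarrow> real" where
  "F_functional n f l x = (\<Sum>i=1..n. l i * f (x i)) - f (\<Sum>i=1..n. l i * x i)"

definition L_functional :: "nat \<Rightarrow> (real \<Rightarrow> real) \<Rightarrow> (nat \<Rightarrow> real) \<Rightarrow> (nat \<Rightarrow> real) \<Rightarrow> real" where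
  "L_functional n f l x =
     (\<Sum>i=1..n. l i * x i * deriv f (x i))
     - (\<Sum>i=1..n. l i * x i) * (\<Sum>i=1..n. l i * deriv f (x i))"

definition Z_functional :: "(real \<Rightarrow> real) \<Rightarrow> real \<Rightarrow> real \<Rightarrow> real" where
  "Z_functional f \<eta>1 \<eta>2 = 1 / 4 * (\<eta>2 - \<eta>1) * (deriv f \<eta>2 - deriv f \<eta>1)"

end

theory Submission
  imports Defs
begin

text \<open>
  All three functionals are linear in the function, so the six inequalities are the single claim
  \<open>0 \<le> F g\<close>, \<open>F g \<le> L g\<close>, \<open>F g \<le> Z g\<close> for convex \<open>g\<close>, applied to the convex functions
  \<open>g = f1 - \<alpha> f2\<close> and \<open>g = \<beta> f2 - f1\<close>. Write \<open>m\<close> for the weighted mean of the \<open>x i\<close>. The first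
  inequality is Jensen's; the second averages the tangent inequalities at the \<open>x i\<close>, evaluated
  at \<open>m\<close>. For the third, the chord over the interval from \<open>\<eta>1\<close> to \<open>\<eta>2\<close> bounds \<open>F g\<close> by its
  distance to \<open>g m\<close>, and the tangents at both endpoints bound that distance.
\<close>

lemma Gamma_simplex_pos: "l \<in> Gamma_simplex n \<Longrightarrow> i \<in> {1..n} \<Longrightarrow> 0 < l i"
  and Gamma_simplex_sum: "l \<in> Gamma_simplex n \<Longrightarrow> (\<Sum>i=1..n. l i) = 1"
  and Gamma_simplex_nonempty: "l \<in> Gamma_simplex n \<Longrightarrow> {1..n} \<noteq> {}"
  unfolding Gamma_simplex_def by (auto intro!: Suc_leI gr0I)

lemma Gamma_simplex_mean_mem:
  fixes x :: "nat \<Rightarrow> real"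
  assumes "l \<in> Gamma_simplex n" and "convex S" and "\<And>i. i \<in> {1..n} \<Longrightarrow> x i \<in> S"
  shows "(\<Sum>i=1..n. l i * x i) \<in> S"
  using convex_sum[of "{1..n}" S l x] assms Gamma_simplex_pos[OF assms(1)]
    Gamma_simplex_sum[OF assms(1)]
  by (simp add: less_imp_le)

text \<open>Lets an average of chord values over the \<open>x i\<close> be read off at the weighted
  mean; \<open>d\<close> survives unscaled because the weights sum to 1.\<close>

lemma Gamma_simplex_sum_affine:
  assumes "l \<in> Gamma_simplex n"
  shows "(\<Sum>i=1..n. l i * (c * x i + d)) = c * (\<Sum>i=1..n. l i * x i) + d"
proof -
  have "(\<Sum>i=1..n. l i * (c * x i + d)) = c * (\<Sum>i=1..n. l i * x i) + d * (\<Sum>i=1..n. l i)"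
    by (simp add: sum_distrib_left sum.distrib algebra_simps)
  then show ?thesis
    using Gamma_simplex_sum[OF assms] by simp
qed

text \<open>Tangent inequality in the form shared by the bounds through \<open>L_functional\<close>
  and \<open>Z_functional\<close>; openness of \<open>S\<close> makes every point of it
  interior.\<close>

lemma convex_above_tangent_deriv:
  fixes g :: "real \<Rightarrow> real"
  assumes "convex_on S g" and "open S" and "g differentiable (at c)" and "c \<in> S" and "t \<in> S"
  shows "deriv g c * (t - c) \<le> g t - g c"
proof (rule convex_on_imp_above_tangent[OF assms(1)])
  show "connected S"
    using assms(1) convex_connected convex_on_imp_convex by blast
  show "c \<in> interior S" "t \<in> S"
    using assms by (simp_all add: interior_open)
  show "(g has_field_derivative deriv g c) (at c within S)"
    using assms(3) DERIV_deriv_iff_real_differentiable has_field_derivative_at_within by blast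
qed

lemma F_functional_nonneg:
  assumes "convex_on S g" and "l \<in> Gamma_simplex n" and "\<And>i. i \<in> {1..n} \<Longrightarrow> x i \<in> S"
  shows "0 \<le> F_functional n g l x"
  using convex_on_sum[of "{1..n}" S g l x] assms Gamma_simplex_nonempty[OF assms(2)]
    Gamma_simplex_pos[OF assms(2)] Gamma_simplex_sum[OF assms(2)]
  by (simp add: F_functional_def less_imp_le)

lemma F_functional_le_L_functional:
  assumes cvx: "convex_on S g" and S: "open S" and diff: "\<And>t. t \<in> S \<Longrightarrow> g differentiable (at t)"
    and l: "l \<in> Gamma_simplex n" and x: "\<And>i. i \<in> {1..n} \<Longrightarrow> x i \<in> S"
  shows "F_functional n g l x \<le> L_functional n g l x"
proof -
  define m where "m = (\<Sum>i=1..n. l i * x i)"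
  have m: "m \<in> S"
    unfolding m_def using Gamma_simplex_mean_mem[OF l convex_on_imp_convex[OF cvx] x] .
  have "(\<Sum>i=1..n. l i * (g (x i) + deriv g (x i) * (m - x i))) \<le> (\<Sum>i=1..n. l i * g m)"
  proof (rule sum_mono)
    fix i assume i: "i \<in> {1..n}"
    have "deriv g (x i) * (m - x i) \<le> g m - g (x i)"
      using convex_above_tangent_deriv[OF cvx S diff[OF x[OF i]] x[OF i] m] .
    then show "l i * (g (x i) + deriv g (x i) * (m - x i)) \<le> l i * g m"
      using Gamma_simplex_pos[OF l i] by (intro mult_left_mono) auto
  qed
  also have "(\<Sum>i=1..n. l i * g m) = g m"
    using Gamma_simplex_sum[OF l] by (simp flip: sum_distrib_right)
  \<comment> \<open>The derivative terms here are exactly \<open>- L_functional n g l x\<close>, so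
    the inequality reads: average of \<open>g (x i)\<close> minus L is at most
    \<open>g m\<close>.\<close>
  also have "(\<Sum>i=1..n. l i * (g (x i) + deriv g (x i) * (m - x i)))
      = (\<Sum>i=1..n. l i * g (x i)) + m * (\<Sum>i=1..n. l i * deriv g (x i))
        - (\<Sum>i=1..n. l i * x i * deriv g (x i))"
    by (simp add: sum_distrib_left sum.distrib sum_subtractf algebra_simps)
  finally show ?thesis
    unfolding F_functional_def L_functional_def m_def[symmetric] by simp
qed

lemma F_functional_le_Z_functional:
  assumes cvx: "convex_on S g" and S: "open S" and diff: "\<And>t. t \<in> S \<Longrightarrow> g differentiable (at t)"
    and l: "l \<in> Gamma_simplex n" and \<eta>: "\<eta>1 \<in> S" "\<eta>2 \<in> S"
    and x: "\<And>i. i \<in> {1..n} \<Longrightarrow> x i \<in> {\<eta>1..\<eta>2}"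
  shows "F_functional n g l x \<le> Z_functional g \<eta>1 \<eta>2"
proof -
  define m where "m = (\<Sum>i=1..n. l i * x i)"
  have m: "m \<in> {\<eta>1..\<eta>2}"
    unfolding m_def using Gamma_simplex_mean_mem[OF l _ x] by simp
  \<comment> \<open>Membership of \<open>m\<close> supplies \<eta>1 \<le> \<eta>2, which identifies
    the closed segment with the interval.\<close>
  have sub: "{\<eta>1..\<eta>2} \<subseteq> S"
    using \<eta> cvx convex_contains_segment convex_on_imp_convex m
    by (metis atLeastAtMost_iff closed_segment_eq_real_ivl order_trans)
  have mS: "m \<in> S"
    using m sub by blast
  \<comment> \<open>The chord slope. If the endpoints coincide, division by zero makes it 0, and the
    chord bound below still holds because every \<open>x i\<close> equals \<eta>1.\<close>
  define K where "K = (g \<eta>2 - g \<eta>1) / (\<eta>2 - \<eta>1)"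
  have "(\<Sum>i=1..n. l i * g (x i)) \<le> (\<Sum>i=1..n. l i * (K * x i + (g \<eta>1 - K * \<eta>1)))"
  proof (rule sum_mono)
    fix i assume i: "i \<in> {1..n}"
    have "g (x i) \<le> K * (x i - \<eta>1) + g \<eta>1"
      unfolding K_def
      by (rule convex_onD_Icc'[OF convex_on_subset[OF cvx sub] x[OF i]]) simp
    then show "l i * g (x i) \<le> l i * (K * x i + (g \<eta>1 - K * \<eta>1))"
      using Gamma_simplex_pos[OF l i] by (intro mult_left_mono) (auto simp: algebra_simps)
  qed
  also have "\<dots> = K * (m - \<eta>1) + g \<eta>1"
    unfolding Gamma_simplex_sum_affine[OF l] m_def by (simp add: algebra_simps)
  finally have F_le: "F_functional n g l x \<le> K * (m - \<eta>1) + g \<eta>1 - g m"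
    unfolding F_functional_def m_def[symmetric] by simp
  show ?thesis
  proof (cases "\<eta>1 = \<eta>2")
    case True
    then show ?thesis
      using F_le m by (simp add: Z_functional_def)
  next
    case False
    \<comment> \<open>The mean splits the interval into lengths \<open>u\<close> and
      \<open>v\<close>; in these terms Z is \<open>d * D / 4\<close>.\<close>
    define d u v D where "d = \<eta>2 - \<eta>1" and "u = m - \<eta>1" and "v = \<eta>2 - m"
      and "D = deriv g \<eta>2 - deriv g \<eta>1"
    have pos: "0 < d" "0 \<le> u" "0 \<le> v" and uv: "u + v = d"
      using False m by (auto simp: d_def u_def v_def)
    note tangent = convex_above_tangent_deriv[OF cvx S diff]
    have t1: "deriv g \<eta>1 * u \<le> g m - g \<eta>1"
      using tangent[OF \<eta>(1) \<eta>(1) mS] by (simp add: u_def)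
    have t2: "- deriv g \<eta>2 * v \<le> g m - g \<eta>2"
      using tangent[OF \<eta>(2) \<eta>(2) mS] by (simp add: v_def algebra_simps)
    \<comment> \<open>Adding the tangent inequalities of the two endpoints, each evaluated at the
      other, shows that the derivative does not decrease.\<close>
    have "0 \<le> d * D"
      using tangent[OF \<eta>(1) \<eta>(1) \<eta>(2)] tangent[OF \<eta>(2) \<eta>(2) \<eta>(1)]
      by (simp add: d_def D_def algebra_simps)
    then have D: "0 \<le> D"
      using pos(1) by (simp add: zero_le_mult_iff)
    have chord: "g \<eta>2 = g \<eta>1 + K * d"
      using pos(1) by (simp add: K_def d_def)
    \<comment> \<open>The weights \<open>v\<close> and \<open>u\<close> are those placing
      \<open>m\<close> between the endpoints: \<open>v * g \<eta>1 + u * g \<eta>2\<close> is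
      \<open>d\<close> times the chord value at \<open>m\<close>, and the slope terms collapse to
      \<open>- u * v * D\<close>.\<close>
    have "v * (deriv g \<eta>1 * u) + u * (- deriv g \<eta>2 * v) \<le> v * (g m - g \<eta>1) + u * (g m - g \<eta>2)"
      using pos t1 t2 by (intro add_mono mult_left_mono)
    then have "d * (K * u + g \<eta>1 - g m) \<le> u * v * D"
      unfolding chord uv[symmetric] D_def by (simp add: algebra_simps)
    also have "\<dots> \<le> d\<^sup>2 / 4 * D"
    proof (rule mult_right_mono[OF _ D])
      \<comment> \<open>The factor 1/4 of Z arises here, from
        \<open>(u + v)\<^sup>2 - 4 * u * v = (u - v)\<^sup>2\<close>.\<close>
      have "0 \<le> (u - v)\<^sup>2" by simp
      then show "u * v \<le> d\<^sup>2 / 4"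
        unfolding uv[symmetric] by (simp add: power2_eq_square algebra_simps)
    qed
    also have "\<dots> = d * (1 / 4 * d * D)"
      by (simp add: power2_eq_square)
    finally have "K * u + g \<eta>1 - g m \<le> 1 / 4 * d * D"
      using pos(1) mult_le_cancel_left_pos by blast
    then show ?thesis
      using F_le by (simp add: Z_functional_def d_def u_def D_def)
  qed
qed

lemma F_functional_linear:
  "F_functional n (\<lambda>t. c * f t + d * h t) l x = c * F_functional n f l x + d * F_functional n h l x"
  by (simp add: F_functional_def sum_distrib_left sum.distrib algebra_simps)

lemma deriv_linear_comb:
  fixes f h :: "real \<Rightarrow> real"
  assumes "f differentiable (at t)" and "h differentiable (at t)"
  shows "deriv (\<lambda>t. c * f t + d * h t) t = c * deriv f t + d * deriv h t"
  using assms unfolding DERIV_deriv_iff_real_differentiable[symmetric]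
  by (intro DERIV_imp_deriv) (auto intro!: derivative_eq_intros)

lemma L_functional_linear:
  assumes "\<And>i. i \<in> {1..n} \<Longrightarrow> f differentiable (at (x i))"
    and "\<And>i. i \<in> {1..n} \<Longrightarrow> h differentiable (at (x i))"
  shows "L_functional n (\<lambda>t. c * f t + d * h t) l x
    = c * L_functional n f l x + d * L_functional n h l x"
proof -
  \<comment> \<open>The weight \<open>w\<close> is kept free because L contains two such sums,
    weighted by \<open>l i\<close> and by \<open>l i * x i\<close>.\<close>
  have "(\<Sum>i=1..n. w i * deriv (\<lambda>t. c * f t + d * h t) (x i))
      = c * (\<Sum>i=1..n. w i * deriv f (x i)) + d * (\<Sum>i=1..n. w i * deriv h (x i))" for w
    using assms by (simp add: deriv_linear_comb sum_distrib_left sum.distrib algebra_simps)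
  from this[of l] this[of "\<lambda>i. l i * x i"] show ?thesis
    unfolding L_functional_def by algebra
qed

lemma Z_functional_linear:
  assumes "f differentiable (at \<eta>1)" and "f differentiable (at \<eta>2)"
    and "h differentiable (at \<eta>1)" and "h differentiable (at \<eta>2)"
  shows "Z_functional (\<lambda>t. c * f t + d * h t) \<eta>1 \<eta>2
    = c * Z_functional f \<eta>1 \<eta>2 + d * Z_functional h \<eta>1 \<eta>2"
  using assms by (simp add: Z_functional_def deriv_linear_comb) (simp add: field_simps)

text \<open>Second derivative test with explicit first and second derivatives, so
  \<open>deriv (deriv _)\<close> of the combination never has to be computed.\<close>

lemma convex_on_linear_comb:
  assumes f: "twice_differentiable_on f S" and h: "twice_differentiable_on h S" and "convex S"
    and nonneg: "\<And>t. t \<in> S \<Longrightarrow> 0 \<le> c * deriv (deriv f) t + d * deriv (deriv h) t"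
  shows "convex_on S (\<lambda>t. c * f t + d * h t)"
proof (rule f''_ge0_imp_convex[OF \<open>convex S\<close> _ _ nonneg])
  fix t assume "t \<in> S"
  then show "((\<lambda>t. c * f t + d * h t) has_field_derivative c * deriv f t + d * deriv h t) (at t)"
    and "((\<lambda>t. c * deriv f t + d * deriv h t) has_field_derivative
      c * deriv (deriv f) t + d * deriv (deriv h) t) (at t)"
    using f h unfolding twice_differentiable_on_def DERIV_deriv_iff_real_differentiable[symmetric]
    by (auto intro!: derivative_eq_intros)
qed

theorem theorem2:
  fixes a b \<alpha> \<beta> \<eta>1 \<eta>2 :: real
    and f1 f2 :: "real \<Rightarrow> real"
    and n :: nat
    and l x :: "nat \<Rightarrow> real"
  assumes "0 \<le> a" and "a < b"
    and "twice_differentiable_on f1 {a<..<b}"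
    and "twice_differentiable_on f2 {a<..<b}"
    and "\<forall>t\<in>{a<..<b}. deriv (deriv f2) t > 0"
    and "\<forall>t\<in>{a<..<b}. \<alpha> \<le> deriv (deriv f1) t / deriv (deriv f2) t
                    \<and> deriv (deriv f1) t / deriv (deriv f2) t \<le> \<beta>"
    and "2 \<le> n"
    and "l \<in> Gamma_simplex n"
    and "\<forall>i\<in>{1..n}. x i \<in> {a<..<b}"
    and "\<eta>1 \<in> {a<..<b}" and "\<eta>2 \<in> {a<..<b}"
    and "\<forall>i\<in>{1..n}. \<eta>1 \<le> x i \<and> x i \<le> \<eta>2"
  shows
    "(\<alpha> * F_functional n f2 l x \<le> F_functional n f1 l x
      \<and> F_functional n f1 l x \<le> \<beta> * F_functional n f2 l x)
   \<and> (\<alpha> * (L_functional n f2 l x - F_functional n f2 l x)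
        \<le> L_functional n f1 l x - F_functional n f1 l x
      \<and> L_functional n f1 l x - F_functional n f1 l x
        \<le> \<beta> * (L_functional n f2 l x - F_functional n f2 l x))
   \<and> (\<alpha> * (Z_functional f2 \<eta>1 \<eta>2 - F_functional n f2 l x)
        \<le> Z_functional f1 \<eta>1 \<eta>2 - F_functional n f1 l x
      \<and> Z_functional f1 \<eta>1 \<eta>2 - F_functional n f1 l x
        \<le> \<beta> * (Z_functional f2 \<eta>1 \<eta>2 - F_functional n f2 l x))"
proof -
  let ?S = "{a<..<b}"
  note f1 = assms(3) and f2 = assms(4) and l = assms(8)
  have diff: "f1 differentiable (at t)" "f2 differentiable (at t)" if "t \<in> ?S" for t
    using f1 f2 that by (simp_all add: twice_differentiable_on_def)
  have x: "x i \<in> ?S" "x i \<in> {\<eta>1..\<eta>2}" if "i \<in> {1..n}" for i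
    using assms(9,12) that by auto
  \<comment> \<open>Free coefficients let one statement serve both the lower and the upper
    bounds.\<close>
  have comb: "0 \<le> c * F_functional n f1 l x + d * F_functional n f2 l x
    \<and> c * F_functional n f1 l x + d * F_functional n f2 l x
        \<le> c * L_functional n f1 l x + d * L_functional n f2 l x
    \<and> c * F_functional n f1 l x + d * F_functional n f2 l x
        \<le> c * Z_functional f1 \<eta>1 \<eta>2 + d * Z_functional f2 \<eta>1 \<eta>2"
    if "\<And>t. t \<in> ?S \<Longrightarrow> 0 \<le> c * deriv (deriv f1) t + d * deriv (deriv f2) t" for c d
  proof -
    let ?g = "\<lambda>t. c * f1 t + d * f2 t"
    have cvx: "convex_on ?S ?g"
      by (rule convex_on_linear_comb[OF f1 f2 _ that]) auto
    have dg: "?g differentiable (at t)" if "t \<in> ?S" for t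
      using diff[OF that] by simp
    have L: "L_functional n ?g l x = c * L_functional n f1 l x + d * L_functional n f2 l x"
      using diff x by (intro L_functional_linear) auto
    have Z: "Z_functional ?g \<eta>1 \<eta>2 = c * Z_functional f1 \<eta>1 \<eta>2 + d * Z_functional f2 \<eta>1 \<eta>2"
      using diff assms(10,11) by (intro Z_functional_linear) auto
    show ?thesis
      unfolding F_functional_linear[symmetric] L[symmetric] Z[symmetric]
      by (intro conjI F_functional_nonneg[OF cvx l x(1)]
          F_functional_le_L_functional[OF cvx open_greaterThanLessThan dg l x(1)]
          F_functional_le_Z_functional[OF cvx open_greaterThanLessThan dg l assms(10,11) x(2)])
  qed
  \<comment> \<open>Positivity of the second derivative of \<open>f2\<close> clears the quotients,
    giving the sign condition of \<open>comb\<close> for both choices of coefficients.\<close>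
  have "\<alpha> * deriv (deriv f2) t \<le> deriv (deriv f1) t"
    "deriv (deriv f1) t \<le> \<beta> * deriv (deriv f2) t" if "t \<in> ?S" for t
    using assms(5,6) that by (auto simp: pos_le_divide_eq pos_divide_le_eq)
  \<comment> \<open>The pair 1, -\<alpha> yields the three lower bounds and the pair -1, \<beta> the
    three upper ones.\<close>
  then show ?thesis
    using comb[of 1 "- \<alpha>"] comb[of "- 1" \<beta>] by (simp add: algebra_simps)
qed

end
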